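(* Let $\mathscr{B}\subset\mathbb{N}$. The following conditions are equivalent: (i) the unique minimal subset of $(S,X_\eta)$ is a singleton; (ii) $\{(\dots,0,0,0,\dots)\}$ is the unique minimal subset of $(S,X_\eta)$; (iii) $(S,X_\eta)$ is proximal; (iv) $\mathscr{B}$ contains an infinite pairwise coprime subset.
   Context: $\mathbb{N}=\{1,2,\dots\}$. For $\mathscr{B}\subset\mathbb{N}$ let $\mathcal{M}_{\mathscr{B}}:=\bigcup_{b\in\mathscr{B}}b\mathbb{Z}$, $\mathcal{F}_{\mathscr{B}}:=\mathbb{Z}\setminus\mathcal{M}_{\mathscr{B}}$, and let $\eta\in\{0,1\}^{\mathbb{Z}}$ be the characteristic function of $\mathcal{F}_{\mathscr{B}}$. $\{0,1\}^{\mathbb{Z}}$ carries the product topology (with a compatible metric $d$), $S$ is the left shift, $(Sx)(n)=x(n+1)$, and $X_\eta$ is the closure of $\{S^m\eta : m\in\mathbb{Z}\}$. A minimal subset of $(S,X_\eta)$ is a non-empty, closed, $S$-invariant subset of $X_\eta$ that is minimal (under inclusion) with respect to these properties; for every $\mathscr{B}\subset\mathbb{N}$ the subshift $(S,X_\eta)$ has exactly one minimal subset. $(S,X_\eta)$ is proximal if $\liminf_{n\to\infty}d(S^nx,S^ny)=0$ for all $x,y\in X_\eta$. A set is pairwise coprime if any two distinct elements have greatest common divisor $1$.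
   Formalization: It is additionally assumed that 𝓑 is non-empty and 1 ∉ 𝓑; otherwise the claim fails: for 𝓑=∅, (i),(iii) hold but (ii),(iv) fail; for 𝓑={1}, (i)–(iii) hold but (iv) fails. *)

theory Defs
  imports "HOL-Analysis.Analysis"
begin

text \<open>The space \<open>{0,1}\<^sup>\<int>\<close> is modelled by the type \<open>int \<Rightarrow> bool\<close>, with \<open>False\<close> for 0 and
  \<open>True\<close> for 1. The library topology on \<open>bool\<close> is discrete and the one on functions is the product
  topology, so \<open>closure\<close> and \<open>closed\<close> below refer to the product topology.\<close>

definition multiples :: "nat set \<Rightarrow> int set" where
  "multiples B = (\<Union>b\<in>B. {int b * k | k. True})"

definition free_set :: "nat set \<Rightarrow> int set" where
  "free_set B = UNIV - multiples B"

definition eta :: "nat set \<Rightarrow> int \<Rightarrow> bool" where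
  "eta B = (\<lambda>n. n \<in> free_set B)"

definition shift :: "(int \<Rightarrow> 'a) \<Rightarrow> int \<Rightarrow> 'a" where
  "shift x = (\<lambda>n. x (n + 1))"

text \<open>All integer powers of the shift; the two lemmas confirm that these are its
  iterates and the inverses of its iterates.\<close>

definition shift_pow :: "int \<Rightarrow> (int \<Rightarrow> 'a) \<Rightarrow> int \<Rightarrow> 'a" where
  "shift_pow m x = (\<lambda>n. x (n + m))"

lemma shift_pow_of_nat: "shift_pow (int k) = (shift ^^ k)"
  by (induction k) (auto simp: shift_pow_def shift_def fun_eq_iff algebra_simps)

lemma shift_pow_uminus: "shift_pow (- m) (shift_pow m x) = x" "shift_pow m (shift_pow (- m) x) = x"
  by (auto simp: shift_pow_def)

definition subshift :: "nat set \<Rightarrow> (int \<Rightarrow> bool) set" where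
  "subshift B = closure {shift_pow m (eta B) | m. True}"

text \<open>Invariance is \<open>shift ` M \<subseteq> M\<close>; since the space is compact, demanding equality
  instead would yield the same minimal subsets.\<close>

definition closed_invariant_in :: "(int \<Rightarrow> bool) set \<Rightarrow> (int \<Rightarrow> bool) set \<Rightarrow> bool" where
  "closed_invariant_in X M \<longleftrightarrow> M \<noteq> {} \<and> closed M \<and> shift ` M \<subseteq> M \<and> M \<subseteq> X"

definition minimal_subset :: "(int \<Rightarrow> bool) set \<Rightarrow> (int \<Rightarrow> bool) set \<Rightarrow> bool" where
  "minimal_subset X M \<longleftrightarrow>
     closed_invariant_in X M \<and> (\<forall>N. closed_invariant_in X N \<and> N \<subseteq> M \<longrightarrow> N = M)"

definition unique_minimal_subset :: "(int \<Rightarrow> bool) set \<Rightarrow> (int \<Rightarrow> bool) set \<Rightarrow> bool" where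
  "unique_minimal_subset X M \<longleftrightarrow>
     minimal_subset X M \<and> (\<forall>N. minimal_subset X N \<longrightarrow> N = M)"

definition compatible_metric :: "((int \<Rightarrow> bool) \<Rightarrow> (int \<Rightarrow> bool) \<Rightarrow> real) \<Rightarrow> bool" where
  "compatible_metric d \<longleftrightarrow> Metric_space UNIV d \<and> Metric_space.mtopology UNIV d = euclidean"

lemma ex_compatible_metric: "\<exists>d. compatible_metric d"
proof -
  have bool: "(euclidean :: bool topology) = discrete_topology UNIV"
    by (simp add: topology_eq open_discrete)
  have "metrizable_space (product_topology (\<lambda>_::int. euclidean :: bool topology) UNIV)"
    unfolding metrizable_space_product_topology bool by (auto simp: metrizable_space_discrete_topology)
  then have "metrizable_space (euclidean :: (int \<Rightarrow> bool) topology)"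
    by (simp add: euclidean_product_topology)
  then obtain M d where *: "Metric_space M d" "euclidean = Metric_space.mtopology M (d :: (int \<Rightarrow> bool) \<Rightarrow> _)"
    unfolding metrizable_space_def by blast
  then have "M = UNIV"
    by (metis Metric_space.topspace_mtopology topspace_euclidean)
  with * show ?thesis
    by (auto simp: compatible_metric_def)
qed

text \<open>The limit inferior is taken in \<open>ereal\<close>, as \<open>Liminf\<close> needs a complete lattice.\<close>

definition proximal :: "((int \<Rightarrow> bool) \<Rightarrow> (int \<Rightarrow> bool) \<Rightarrow> real) \<Rightarrow> (int \<Rightarrow> bool) set \<Rightarrow> bool" where
  "proximal d X \<longleftrightarrow>
     (\<forall>x\<in>X. \<forall>y\<in>X. liminf (\<lambda>n. ereal (d ((shift ^^ n) x) ((shift ^^ n) y))) = 0)"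

end

theory Submission
  imports Defs "HOL-Number_Theory.Cong"
begin

text \<open>
  Everything is decided by whether the zero sequence lies in the subshift.

  If every \<open>b \<in> B\<close> shares a factor with a fixed \<open>N > 0\<close>, then no integer congruent to 1 modulo
  \<open>N\<close> is a multiple of an element of \<open>B\<close>, so the zero blocks of \<open>eta B\<close> are bounded and zero is not
  in the subshift. Such an \<open>N\<close> exists as soon as \<open>B\<close> has a finite maximal pairwise coprime subset:
  take the product of its elements (\<open>pairwise_coprime_dichotomy\<close>). Hence, if zero is in the
  subshift, a maximal pairwise coprime subset of \<open>B\<close> is infinite.

  Conversely, every point \<open>x\<close> of the subshift inherits from \<open>eta B\<close> that for each \<open>b \<in> B\<close> it vanishes
  on a whole residue class modulo \<open>b\<close>. With infinitely many pairwise coprime moduli at hand, a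
  different modulus can be spent on each position of a window and on each of two points \<open>x\<close>, \<open>y\<close>.
  The Chinese remainder theorem then gives arbitrarily late times at which \<open>x\<close> and \<open>y\<close> both
  vanish on the window (\<open>simultaneous_zeros\<close>), which is proximality.

  Finally, proximality of \<open>x\<close> and \<open>shift x\<close> makes \<open>d z (shift z)\<close> arbitrarily small along the orbit
  of \<open>x\<close>. By compactness every nonempty closed invariant subset contains a fixed point of the shift
  (\<open>proximal_imp_fixed_point\<close>). Fixed points are constant, and the constant 1 is not in the
  subshift because an element of \<open>B\<close> forces zeros, so zero lies in every nonempty closed invariant subset.
\<close>

section \<open>The shift and the subshift\<close>

lemma continuous_on_shift: "continuous_on S (shift :: (int \<Rightarrow> bool) \<Rightarrow> int \<Rightarrow> bool)"
  unfolding shift_def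
  by (intro continuous_on_coordinatewise_then_product
        continuous_on_product_coordinates[THEN continuous_on_subset]) auto

lemma funpow_shift: "(shift ^^ k) x = (\<lambda>n. x (n + int k))"
  by (simp add: shift_pow_def flip: shift_pow_of_nat)

lemma shift_fixed_point_const:
  assumes "shift x = x"
  shows "x = (\<lambda>_. x 0)"
proof
  fix n
  have step: "x (m + 1) = x m" for m
    using assms by (metis shift_def)
  show "x n = x 0"
  proof (induction n rule: int_induct[where k = 0])
    case (step2 i)
    then show ?case using step[of "i - 1"] by simp
  qed (simp_all add: step)
qed

lemma closed_subshift: "closed (subshift B)"
  by (simp add: subshift_def)

lemma shift_pow_eta_in_subshift: "shift_pow m (eta B) \<in> subshift B"
  unfolding subshift_def by (rule closure_subset[THEN subsetD]) blast

lemma shift_subshift: "shift ` subshift B \<subseteq> subshift B"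
proof -
  have "shift (shift_pow m (eta B)) = shift_pow (m + 1) (eta B)" for m
    by (simp add: shift_def shift_pow_def algebra_simps)
  then have "shift ` {shift_pow m (eta B) | m. True} \<subseteq> subshift B"
    using shift_pow_eta_in_subshift by auto
  then show ?thesis
    unfolding subshift_def
    by (intro image_closure_subset continuous_on_shift) (auto simp: subshift_def)
qed

lemma closed_invariant_subshift: "closed_invariant_in (subshift B) (subshift B)"
  unfolding closed_invariant_in_def
  using closed_subshift shift_subshift shift_pow_eta_in_subshift by blast

lemma closed_zero_at: "closed {x :: int \<Rightarrow> bool. \<not> x i}"
proof -
  have "closed ((\<lambda>x :: int \<Rightarrow> bool. x i) -` {False})"
    by (intro closed_vimage continuous_on_product_coordinates) simp
  then show ?thesis by (simp add: vimage_def)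
qed

lemma open_zero_at: "open {x :: int \<Rightarrow> bool. \<not> x i}"
proof -
  have "open ((\<lambda>x :: int \<Rightarrow> bool. x i) -` {False})"
    by (intro open_vimage continuous_on_product_coordinates) (simp add: open_discrete)
  then show ?thesis by (simp add: vimage_def)
qed

text \<open>A multiple of \<open>b\<close> is never \<open>B\<close>-free, so a translate of \<open>eta B\<close> vanishes on a residue class
  modulo \<open>b\<close>. This survives the closure because there are only finitely many classes.\<close>

lemma subshift_zero_on_residue_class:
  assumes x: "x \<in> subshift B" and b: "b \<in> B" "b > 0"
  obtains r where "\<And>n. [n = r] (mod int b) \<Longrightarrow> \<not> x n"
proof -
  let ?C = "\<Union>r\<in>{0..<int b}. {x :: int \<Rightarrow> bool. \<forall>n. [n = r] (mod int b) \<longrightarrow> \<not> x n}"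
  have "closed ?C"
    by (intro closed_UN ballI closed_Collect_all closed_Collect_imp closed_zero_at) auto
  moreover have "shift_pow m (eta B) \<in> ?C" for m
  proof -
    have "\<not> shift_pow m (eta B) n" if "[n = (- m) mod int b] (mod int b)" for n
    proof -
      have "[n = - m] (mod int b)" using that by simp
      then have "int b dvd n + m"
        by (simp add: cong_iff_dvd_diff)
      then show ?thesis
        using b by (auto simp: shift_pow_def eta_def free_set_def multiples_def dvd_def)
    qed
    moreover have "(- m) mod int b \<in> {0..<int b}" using b by simp
    ultimately show ?thesis by blast
  qed
  ultimately have "subshift B \<subseteq> ?C"
    unfolding subshift_def by (intro closure_minimal) auto
  with x that show ?thesis by blast
qed

lemma const_True_notin_subshift:
  assumes "0 \<notin> B" "B \<noteq> {}"
  shows "(\<lambda>_. True) \<notin> subshift B"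
proof
  assume T: "(\<lambda>_. True) \<in> subshift B"
  obtain b where b: "b \<in> B" "b > 0"
    using assms by (metis equals0I gr0I)
  show False
    using subshift_zero_on_residue_class[OF T b] cong_refl by metis
qed

lemma shift_fixed_point_in_subshift:
  assumes "0 \<notin> B" "B \<noteq> {}" "x \<in> subshift B" "shift x = x"
  shows "x = (\<lambda>_. False)"
  using shift_fixed_point_const[OF assms(4)] const_True_notin_subshift[OF assms(1,2)] assms(3)
  by (cases "x 0") auto

section \<open>Coprime subsets and zero blocks\<close>

text \<open>A maximal pairwise coprime subset, provided by Zorn's lemma, is either infinite or has a
  product \<open>N\<close>. In the latter case an element of \<open>B\<close> coprime to \<open>N\<close> could be added to the subset.\<close>

lemma pairwise_coprime_dichotomy:
  assumes "0 \<notin> B" and "1 \<notin> (B :: nat set)"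
  shows "(\<exists>A. A \<subseteq> B \<and> infinite A \<and> pairwise coprime A)
    \<or> (\<exists>N>0. \<forall>b\<in>B. \<not> coprime b N)"
proof -
  let ?P = "{A. A \<subseteq> B \<and> pairwise coprime A}"
  have "\<exists>M\<in>?P. \<forall>X\<in>?P. M \<subseteq> X \<longrightarrow> X = M"
  proof (rule subset_Zorn')
    fix C assume C: "subset.chain ?P C"
    then have "chain\<^sub>\<subseteq> C"
      by (simp add: chain_subset_alt_def subset_chain_def)
    then have "pairwise coprime (\<Union>C)"
      using C by (intro pairwise_chain_Union) (auto simp: subset_chain_def)
    with C show "\<Union>C \<in> ?P" by (auto simp: subset_chain_def)
  qed
  then obtain A where "A \<in> ?P" and "\<forall>X\<in>?P. A \<subseteq> X \<longrightarrow> X = A" ..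
  then have A: "A \<subseteq> B" "pairwise coprime A"
    and max: "\<And>X. X \<subseteq> B \<Longrightarrow> pairwise coprime X \<Longrightarrow> A \<subseteq> X \<Longrightarrow> X = A"
    by simp_all
  show ?thesis
  proof (cases "finite A")
    case True
    have "\<not> coprime b (\<Prod>A)" if b: "b \<in> B" for b
    proof
      assume "coprime b (\<Prod>A)"
      then have cop: "coprime b a" if "a \<in> A" for a
        using that dvd_prodI[OF True that, of "\<lambda>a. a"]
        by (intro coprime_divisors[of b b a "\<Prod>A"]) (simp_all add: \<open>coprime b (\<Prod>A)\<close>)
      then have "pairwise coprime (insert b A)"
        using A(2) by (simp add: pairwise_insert coprime_commute)
      then have "b \<in> A"
        using max[of "insert b A"] A(1) b by auto
      with cop have "b = 1" by force
      with b assms show False by simp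
    qed
    moreover have "\<Prod>A > 0"
      using A(1) assms(1) by (intro prod_pos) (metis gr0I subsetD)
    ultimately show ?thesis by blast
  qed (use A in blast)
qed

text \<open>A common divisor of \<open>b\<close> and \<open>N\<close> that divides an integer congruent to 1 modulo \<open>N\<close> is a
  unit, so all these integers are \<open>B\<close>-free and no translate of \<open>eta B\<close> has \<open>N\<close> consecutive zeros.\<close>

lemma zero_notin_subshift:
  assumes N: "N > 0" and B: "\<And>b. b \<in> B \<Longrightarrow> \<not> coprime b N"
  shows "(\<lambda>_. False) \<notin> subshift B"
proof
  assume "(\<lambda>_. False) \<in> subshift B"
  then have "(\<Inter>i\<in>{0..<int N}. {x. \<not> x i}) \<inter> closure {shift_pow m (eta B) | m. True} \<noteq> {}"
    by (auto simp: subshift_def)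
  moreover have "open (\<Inter>i\<in>{0..<int N}. {x :: int \<Rightarrow> bool. \<not> x i})"
    by (intro open_INT ballI open_zero_at) auto
  ultimately have "(\<Inter>i\<in>{0..<int N}. {x. \<not> x i}) \<inter> {shift_pow m (eta B) | m. True} \<noteq> {}"
    by (simp only: open_Int_closure_eq_empty not_False_eq_True)
  then obtain m where m: "\<And>i. i \<in> {0..<int N} \<Longrightarrow> \<not> eta B (i + m)"
    unfolding shift_pow_def by blast
  define n where "n = (1 - m) mod int N + m"
  have "[n = 1] (mod int N)"
    by (simp add: n_def cong_def mod_simps)
  then have dvd: "int N dvd n - 1" by (simp add: cong_iff_dvd_diff)
  have "eta B n"
  proof -
    have "\<not> int b dvd n" if "b \<in> B" for b
    proof
      assume b: "int b dvd n"
      have "coprime (int b) (int N)"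
      proof (rule coprimeI)
        fix c assume "c dvd int b" "c dvd int N"
        then have "c dvd n - (n - 1)"
          using b dvd by (meson dvd_diff dvd_trans)
        then show "is_unit c" by simp
      qed
      with B that show False by simp
    qed
    then show ?thesis
      unfolding eta_def free_set_def multiples_def by (fastforce intro: dvdI)
  qed
  moreover have "(1 - m) mod int N \<in> {0..<int N}" using N by simp
  ultimately show False using m n_def by blast
qed

text \<open>Each condition \<open>\<not> z (n + p)\<close> is implied by a congruence on \<open>n\<close> modulo any chosen element of
  \<open>B\<close>. Assigning distinct elements of \<open>A\<close> to the finitely many conditions makes the congruences
  solvable together.\<close>

lemma simultaneous_zeros:
  assumes B: "0 \<notin> B" and A: "A \<subseteq> B" "infinite A" "pairwise coprime A"
    and I: "finite I" "\<And>z p. (z, p) \<in> I \<Longrightarrow> z \<in> subshift B"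
  obtains n where "n \<ge> k" "\<And>z p. (z, p) \<in> I \<Longrightarrow> \<not> z (int n + p)"
proof -
  obtain A' where A': "A' \<subseteq> A" "finite A'" "card A' = card I"
    using infinite_arbitrarily_large[OF A(2)] by metis
  then obtain f where f: "bij_betw f I A'"
    using I(1) finite_same_card_bij by metis
  have fB: "f i \<in> B" "f i > 0" if "i \<in> I" for i
  proof -
    show "f i \<in> B" using bij_betwE[OF f] that A' A by blast
    then show "f i > 0" using B by (metis gr0I)
  qed
  have "\<exists>r. \<forall>n. [n = r] (mod int (f i)) \<longrightarrow> \<not> fst i n" if "i \<in> I" for i
    using subshift_zero_on_residue_class[OF I(2) fB[OF that]] that
    by (metis prod.collapse)
  then obtain r where r: "\<And>i n. i \<in> I \<Longrightarrow> [n = r i] (mod int (f i)) \<Longrightarrow> \<not> fst i n"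
    by metis
  \<comment> \<open>The solution is sought in the form \<open>n = x + k\<close>, which takes care of \<open>n \<ge> k\<close>.\<close>
  define u where "u i = nat ((r i - snd i - int k) mod int (f i))" for i
  have u: "[int (u i) = r i - snd i - int k] (mod int (f i))" if "i \<in> I" for i
    using fB(2)[OF that] by (simp add: u_def)
  have "\<forall>i\<in>I. \<forall>j\<in>I. i \<noteq> j \<longrightarrow> coprime (f i) (f j)"
    using f A(3) A'(1) by (meson bij_betwE bij_betw_imp_inj_on inj_onD pairwiseD subsetD)
  then obtain x where x: "\<And>i. i \<in> I \<Longrightarrow> [x = u i] (mod f i)"
    using chinese_remainder_nat[OF I(1)] by metis
  show ?thesis
  proof (rule that)
    show "x + k \<ge> k" by simp
    fix z p assume zp: "(z, p) \<in> I"
    have "[int x = int (u (z, p))] (mod int (f (z, p)))"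
      using x[OF zp] by (simp add: cong_int_iff)
    then have "[int x = r (z, p) - p - int k] (mod int (f (z, p)))"
      using u[OF zp] cong_trans by fastforce
    then have "[int (x + k) + p = r (z, p)] (mod int (f (z, p)))"
      by (simp add: cong_iff_dvd_diff algebra_simps)
    with r[OF zp] show "\<not> z (int (x + k) + p)" by simp
  qed
qed

section \<open>Proximality\<close>

lemma liminf_ereal_eq_0_iff:
  assumes "\<And>n. 0 \<le> f n"
  shows "liminf (\<lambda>n. ereal (f n)) = 0 \<longleftrightarrow> (\<forall>e>0. \<forall>k. \<exists>n\<ge>k. f n < e)" (is "?L = 0 \<longleftrightarrow> ?R")
proof
  assume L: "?L = 0"
  show ?R
  proof (rule ccontr)
    assume "\<not> ?R"
    then obtain e k where e: "e > 0" "\<forall>n\<ge>k. e \<le> f n" by (meson not_less)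
    then have "\<forall>\<^sub>F n in sequentially. ereal e \<le> ereal (f n)"
      by (auto simp: eventually_sequentially)
    from Liminf_bounded[OF this] L e(1) show False by (simp add: zero_ereal_def)
  qed
next
  assume R: ?R
  have "?L \<ge> 0" by (intro Liminf_bounded) (simp add: assms)
  moreover have "\<not> 0 < ?L"
  proof
    assume "0 < ?L"
    then obtain e where e: "0 < ereal e" "ereal e < ?L"
      using ereal_dense2 by blast
    from less_LiminfD[OF e(2)] obtain k where "\<forall>n\<ge>k. e < f n"
      by (auto simp: eventually_sequentially)
    moreover obtain n where "n \<ge> k" "f n < e" using R e(1) by auto
    ultimately show False by fastforce
  qed
  ultimately show "?L = 0" by simp
qed

lemma proximal_iff:
  assumes "compatible_metric d"
  shows "proximal d X \<longleftrightarrow>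
    (\<forall>x\<in>X. \<forall>y\<in>X. \<forall>e>0. \<forall>k. \<exists>n\<ge>k. d ((shift ^^ n) x) ((shift ^^ n) y) < e)"
proof -
  have "0 \<le> d x y" for x y
    using assms unfolding compatible_metric_def by (metis Metric_space.nonneg)
  then show ?thesis
    unfolding proximal_def by (simp add: liminf_ereal_eq_0_iff)
qed

lemma compatible_metric_small_near_zero:
  assumes d: "compatible_metric d" and e: "e > 0"
  obtains F where "finite F" "\<And>z. (\<And>i. i \<in> F \<Longrightarrow> \<not> z i) \<Longrightarrow> d (\<lambda>_. False) z < e"
proof -
  interpret Metric_space UNIV d using d by (simp add: compatible_metric_def)
  have "openin euclidean (mball (\<lambda>_. False) e)"
    using d openin_mball by (metis compatible_metric_def)
  then have "openin (product_topology (\<lambda>_. euclidean) UNIV) (mball (\<lambda>_. False) e)"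
    by (simp add: euclidean_product_topology)
  moreover have "(\<lambda>_. False) \<in> mball (\<lambda>_. False) e" using e by simp
  ultimately obtain V where V: "(\<lambda>_. False) \<in> (\<Pi>\<^sub>E i\<in>UNIV. V i)"
      "finite {i. V i \<noteq> UNIV}" "(\<Pi>\<^sub>E i\<in>UNIV. V i) \<subseteq> mball (\<lambda>_. False) e"
    using product_topology_open_contains_basis[of "\<lambda>_. euclidean" UNIV
        "mball (\<lambda>_. False) e" "\<lambda>_. False"]
    unfolding topspace_euclidean by blast
  show ?thesis
  proof (rule that[OF V(2)])
    fix z assume z: "\<And>i. i \<in> {i. V i \<noteq> UNIV} \<Longrightarrow> \<not> z i"
    have "z i \<in> V i" for i
      using z[of i] V(1) by (cases "V i = UNIV") (auto simp: PiE_iff)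
    then have "z \<in> (\<Pi>\<^sub>E i\<in>UNIV. V i)" by (simp add: PiE_iff)
    with V(3) show "d (\<lambda>_. False) z < e" by auto
  qed
qed

lemma compatible_metric_continuous:
  assumes d: "compatible_metric d" and f: "continuous_on UNIV f" and g: "continuous_on UNIV g"
  shows "continuous_on UNIV (\<lambda>x. d (f x) (g x))"
proof -
  let ?m = "metric (UNIV, d)"
  have ms: "Metric_space UNIV d" using d by (simp add: compatible_metric_def)
  have top: "mtopology_of ?m = euclidean"
    using d by (simp add: mtopology_of_def ms compatible_metric_def Metric_space.mspace_metric Metric_space.mdist_metric)
  have "continuous_map euclidean euclidean (\<lambda>x. mdist ?m (f x) (g x))"
    using f g by (intro continuous_map_mdist) (simp_all add: top)
  then show ?thesis by (simp add: ms Metric_space.mdist_metric)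
qed

lemma infinite_coprime_subset_imp_proximal:
  assumes d: "compatible_metric d" and B: "0 \<notin> B"
    and A: "A \<subseteq> B" "infinite A" "pairwise coprime A"
  shows "proximal d (subshift B)"
  unfolding proximal_iff[OF d]
proof (intro ballI allI impI)
  fix x y e and k :: nat
  assume xy: "x \<in> subshift B" "y \<in> subshift B" and e: "(e::real) > 0"
  interpret Metric_space UNIV d using d by (simp add: compatible_metric_def)
  obtain F where F: "finite F" "\<And>z. (\<And>i. i \<in> F \<Longrightarrow> \<not> z i) \<Longrightarrow> d (\<lambda>_. False) z < e / 2"
    using compatible_metric_small_near_zero[OF d, of "e / 2"] e by auto
  obtain n where n: "n \<ge> k" "\<And>z p. (z, p) \<in> {x, y} \<times> F \<Longrightarrow> \<not> z (int n + p)"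
    using simultaneous_zeros[OF B A, of "{x, y} \<times> F" k] F(1) xy by auto
  have "d (\<lambda>_. False) ((shift ^^ n) z) < e / 2" if "z \<in> {x, y}" for z
    using n(2) that by (intro F(2)) (auto simp: funpow_shift add.commute)
  then have "d ((shift ^^ n) x) ((shift ^^ n) y) < e"
    using triangle[of "(shift ^^ n) x" "\<lambda>_. False" "(shift ^^ n) y"]
      commute[of "(shift ^^ n) x" "\<lambda>_. False"] by (smt (verit) UNIV_I field_sum_of_halves insertCI)
  with n(1) show "\<exists>n\<ge>k. d ((shift ^^ n) x) ((shift ^^ n) y) < e" by blast
qed

text \<open>The continuous function \<open>\<lambda>z. d z (shift z)\<close> attains its minimum on the compact set \<open>M\<close>, and
  proximality of a point and its shift makes its infimum 0.\<close>

lemma proximal_imp_fixed_point: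
  assumes d: "compatible_metric d" and X: "proximal d X" and M: "closed_invariant_in X M"
  obtains z where "z \<in> M" "shift z = z"
proof -
  interpret Metric_space UNIV d using d by (simp add: compatible_metric_def)
  have MX: "M \<noteq> {}" "closed M" "shift ` M \<subseteq> M" "M \<subseteq> X"
    using M by (auto simp: closed_invariant_in_def)
  have "compact_space (euclidean :: bool topology)"
    by (simp add: compact_space_def finite_imp_compact)
  then have "compact_space (euclidean :: (int \<Rightarrow> bool) topology)"
    unfolding euclidean_product_topology[symmetric] compact_space_product_topology by simp
  then have "compact (UNIV :: (int \<Rightarrow> bool) set)" by (simp add: compact_space_def)
  then have "compact M" using MX(2) compact_Int_closed[of UNIV M] by simp
  moreover have "continuous_on M (\<lambda>z. d z (shift z))"
    using compatible_metric_continuous[OF d continuous_on_id continuous_on_shift]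
      continuous_on_subset by blast
  ultimately obtain z where z: "z \<in> M" "\<And>w. w \<in> M \<Longrightarrow> d z (shift z) \<le> d w (shift w)"
    using continuous_attains_inf MX(1) by metis
  have "\<not> 0 < d z (shift z)"
  proof
    assume pos: "0 < d z (shift z)"
    have "z \<in> X" "shift z \<in> X" using z(1) MX by auto
    then obtain n where "d ((shift ^^ n) z) ((shift ^^ n) (shift z)) < d z (shift z)"
      using X pos unfolding proximal_iff[OF d] by blast
    moreover have "(shift ^^ n) z \<in> M"
      by (induction n) (use z(1) MX(3) in auto)
    ultimately show False
      using z(2)[of "(shift ^^ n) z"] by (simp add: funpow_swap1)
  qed
  then have "d z (shift z) = 0" using nonneg[of z "shift z"] by linarith
  then have "shift z = z" by simp
  with z(1) that show ?thesis by blast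
qed

lemma proximal_imp_unique_minimal_zero:
  assumes B: "0 \<notin> B" "B \<noteq> {}" and d: "compatible_metric d" and X: "proximal d (subshift B)"
  shows "unique_minimal_subset (subshift B) {\<lambda>_. False}"
proof -
  have zero: "(\<lambda>_. False) \<in> M" if M: "closed_invariant_in (subshift B) M" for M
  proof -
    obtain z where z: "z \<in> M" "shift z = z"
      by (rule proximal_imp_fixed_point[OF d X M])
    with M have "z \<in> subshift B" by (auto simp: closed_invariant_in_def)
    with z shift_fixed_point_in_subshift[OF B] show ?thesis by metis
  qed
  have "{\<lambda>_. False} = {x :: int \<Rightarrow> bool. \<forall>i. \<not> x i}" by auto
  then have "closed {\<lambda>_ :: int. False}"
    using closed_Collect_all[of "\<lambda>i x. \<not> x i", OF closed_zero_at] by simp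
  then have "closed_invariant_in (subshift B) {\<lambda>_. False}"
    using zero[OF closed_invariant_subshift] by (auto simp: closed_invariant_in_def shift_def)
  with zero show ?thesis
    unfolding unique_minimal_subset_def minimal_subset_def by blast
qed

section \<open>The equivalence\<close>

theorem theorem2:
  fixes B :: "nat set"
    and d :: "(int \<Rightarrow> bool) \<Rightarrow> (int \<Rightarrow> bool) \<Rightarrow> real"
  assumes "0 \<notin> B" and "B \<noteq> {}" and "1 \<notin> B"
    and "compatible_metric d"
  shows "((\<exists>M. unique_minimal_subset (subshift B) M \<and> is_singleton M)
           \<longleftrightarrow> unique_minimal_subset (subshift B) {\<lambda>_. False})
       \<and> (unique_minimal_subset (subshift B) {\<lambda>_. False}
           \<longleftrightarrow> proximal d (subshift B))
       \<and> (proximal d (subshift B)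
           \<longleftrightarrow> (\<exists>A. A \<subseteq> B \<and> infinite A \<and> pairwise coprime A))"
    (is "(?i \<longleftrightarrow> ?ii) \<and> (?ii \<longleftrightarrow> ?iii) \<and> (?iii \<longleftrightarrow> ?iv)")
proof -
  have "?i \<Longrightarrow> ?ii"
  proof -
    assume ?i
    then obtain x where x: "unique_minimal_subset (subshift B) {x}"
      by (auto simp: is_singleton_def)
    then have "closed_invariant_in (subshift B) {x}"
      by (simp add: unique_minimal_subset_def minimal_subset_def)
    then have "x = (\<lambda>_. False)"
      by (intro shift_fixed_point_in_subshift[OF assms(1,2)]) (auto simp: closed_invariant_in_def)
    with x show ?ii by simp
  qed
  moreover have "?ii \<Longrightarrow> ?i" by (auto simp: is_singleton_def)
  moreover have "?ii \<Longrightarrow> ?iv"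
  proof -
    assume ?ii
    then have "(\<lambda>_. False) \<in> subshift B"
      by (simp add: unique_minimal_subset_def minimal_subset_def closed_invariant_in_def)
    then show ?iv
      using pairwise_coprime_dichotomy[OF assms(1,3)] zero_notin_subshift by blast
  qed
  moreover have "?iv \<Longrightarrow> ?iii"
    using infinite_coprime_subset_imp_proximal[OF assms(4,1)] by blast
  moreover have "?iii \<Longrightarrow> ?ii"
    by (rule proximal_imp_unique_minimal_zero[OF assms(1,2,4)])
  ultimately show ?thesis by blast
qed

end
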